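(* Let $m_1,\dots,m_5$ be positive masses and let $\mathbf q=(\mathbf q_1,\dots,\mathbf q_5)$ be a configuration on $\mathbb S^3$ with $d_{ij}\in(0,\pi)$ for all $i\neq j$. Then $\mathbf q$ is a Dziobek equilibrium configuration of the curved 5-body problem if and only if $$\sin d_{13}\sin d_{25}=\sin d_{12}\sin d_{35}=\sin d_{23}\sin d_{15},\qquad \sin d_{34}\sin d_{15}=\sin d_{14}\sin d_{35},$$ $$\sin d_{14}\sin d_{25}=\sin d_{12}\sin d_{45}=\sin d_{24}\sin d_{15},$$ $\Delta_5\neq0$, and the masses satisfy $$(m_1,\dots,m_5)=\left(\frac{\sin^3 d_{12}\,\Delta_1}{\sin^3 d_{25}\,\Delta_5},\ \frac{\sin^3 d_{12}\,\Delta_2}{\sin^3 d_{15}\,\Delta_5},\ \frac{\sin^3 d_{13}\,\Delta_3}{\sin^3 d_{15}\,\Delta_5},\ \frac{\sin^3 d_{14}\,\Delta_4}{\sin^3 d_{15}\,\Delta_5},\ 1\right)m_5.$$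
   Context: $\mathbb S^3$ is the unit sphere of $\mathbb R^4$; $d_{ij}\in[0,\pi]$ is the geodesic distance, $\cos d_{ij}=\mathbf q_i\cdot\mathbf q_j$. The curved $N$-body potential is $V(\mathbf q)=-\sum_{1\le i<j\le N}m_im_j\cot d_{ij}$ (here $N=5$), defined when all $d_{ij}\in(0,\pi)$. An equilibrium configuration is a critical point of $V$, i.e. a configuration with $\sum_{j\ne i}\frac{m_im_j}{\sin^3 d_{ij}}[\mathbf q_j-\cos d_{ij}\,\mathbf q_i]=0$ for every $i$. A configuration of $N$ bodies is Dziobek if $\operatorname{rank}(\mathbf q_1,\dots,\mathbf q_N)=N-1$; a Dziobek equilibrium configuration is an equilibrium configuration that is Dziobek. $\Delta_k=(-1)^{k+1}\det X_k$, where $X_k$ is the $4\times4$ matrix obtained from $X=[\mathbf q_1,\dots,\mathbf q_5]$ (columns $\mathbf q_i\in\mathbb R^4$) by deleting the $k$-th column. *)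

theory Defs
  imports "HOL-Analysis.Analysis"
begin

text \<open>
  Bodies are labelled by the natural numbers \<open>1, \<dots>, N\<close>; masses and positions are functions on
  \<^typ>\<open>nat\<close> whose values outside \<open>{1..N}\<close> are irrelevant.
\<close>

definition geod_dist :: "real^4 \<Rightarrow> real^4 \<Rightarrow> real" where
  "geod_dist x y = arccos (x \<bullet> y)"

definition configuration :: "nat \<Rightarrow> (nat \<Rightarrow> real^4) \<Rightarrow> bool" where
  "configuration N q \<longleftrightarrow>
     (\<forall>i\<in>{1..N}. q i \<in> sphere 0 1) \<and>
     (\<forall>i\<in>{1..N}. \<forall>j\<in>{1..N}. i \<noteq> j \<longrightarrow> geod_dist (q i) (q j) \<in> {0<..<pi})"

definition potential :: "nat \<Rightarrow> (nat \<Rightarrow> real) \<Rightarrow> (nat \<Rightarrow> real^4) \<Rightarrow> real" where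
  "potential N m q =
     - (\<Sum>(i, j)\<in>{(i, j). 1 \<le> i \<and> i < j \<and> j \<le> N}. m i * m j * cot (geod_dist (q i) (q j)))"

text \<open>
  A critical point of the potential on the product of spheres: its derivative vanishes along every
  curve of that manifold through \<open>q\<close>. Near time 0 such a curve stays in the open domain of the
  potential.
\<close>

definition equilibrium_configuration ::
    "nat \<Rightarrow> (nat \<Rightarrow> real) \<Rightarrow> (nat \<Rightarrow> real^4) \<Rightarrow> bool" where
  "equilibrium_configuration N m q \<longleftrightarrow>
     configuration N q \<and>
     (\<forall>\<gamma> :: real \<Rightarrow> nat \<Rightarrow> real^4.
        (\<forall>i\<in>{1..N}. \<gamma> 0 i = q i \<and> (\<forall>t. \<gamma> t i \<in> sphere 0 1) \<and> (\<lambda>t. \<gamma> t i) differentiable (at 0))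
        \<longrightarrow> ((\<lambda>t. potential N m (\<gamma> t)) has_real_derivative 0) (at 0))"

text \<open>The rank of a system of vectors is the dimension of their span.\<close>

definition dziobek :: "nat \<Rightarrow> (nat \<Rightarrow> real^4) \<Rightarrow> bool" where
  "dziobek N q \<longleftrightarrow> dim (q ` {1..N}) = N - 1"

definition dziobek_equilibrium_configuration ::
    "nat \<Rightarrow> (nat \<Rightarrow> real) \<Rightarrow> (nat \<Rightarrow> real^4) \<Rightarrow> bool" where
  "dziobek_equilibrium_configuration N m q \<longleftrightarrow> equilibrium_configuration N m q \<and> dziobek N q"

text \<open>
  \<^const>\<open>vector\<close> lists the rows of a matrix, hence the transposition.
\<close>

definition delete_column :: "(nat \<Rightarrow> real^4) \<Rightarrow> nat \<Rightarrow> real^4^4" where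
  "delete_column q k = transpose (vector (map q (remove1 k [1, 2, 3, 4, 5])))"

definition Delta :: "(nat \<Rightarrow> real^4) \<Rightarrow> nat \<Rightarrow> real" where
  "Delta q k = (-1) ^ (k + 1) * det (delete_column q k)"

lemma vector_4:
  "(vector [a, b, c, d] :: 'a::zero^4) $ 1 = a" "(vector [a, b, c, d] :: 'a^4) $ 2 = b"
  "(vector [a, b, c, d] :: 'a^4) $ 3 = c" "(vector [a, b, c, d] :: 'a^4) $ 4 = d"
  by (simp_all add: vector_def)

lemma vector_5:
  "(vector [a, b, c, d, e] :: 'a::zero^5) $ 1 = a" "(vector [a, b, c, d, e] :: 'a^5) $ 2 = b"
  "(vector [a, b, c, d, e] :: 'a^5) $ 3 = c" "(vector [a, b, c, d, e] :: 'a^5) $ 4 = d"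
  "(vector [a, b, c, d, e] :: 'a^5) $ 5 = e"
  by (simp_all add: vector_def)

lemma column_delete_column:
  assumes "k \<in> {1..5}" "j \<in> {1..4}"
  shows "column (of_nat j) (delete_column q k) = q (if j < k then j else j + 1)"
proof -
  have "k = 1 \<or> k = 2 \<or> k = 3 \<or> k = 4 \<or> k = 5" "j = 1 \<or> j = 2 \<or> j = 3 \<or> j = 4"
    using assms by auto
  then show ?thesis
    by (elim disjE; simp add: delete_column_def column_def transpose_def vec_eq_iff vector_4
        flip: numeral_2_eq_2)
qed

lemma dziobek_5_iff_rank:
  "dziobek 5 q \<longleftrightarrow> rank (transpose (vector [q 1, q 2, q 3, q 4, q 5]) :: real^5^4) = 4"
proof -
  have "(UNIV :: 5 set) = of_nat ` {1..5::nat}"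
  proof (rule card_seteq[symmetric])
    have "inj_on (of_nat :: nat \<Rightarrow> 5) {1..5}"
    proof (rule inj_onI)
      fix x y :: nat
      assume "x \<in> {1..5}" "y \<in> {1..5}" and e: "(of_nat x :: 5) = of_nat y"
      then have "x = 1 \<or> x = 2 \<or> x = 3 \<or> x = 4 \<or> x = 5" "y = 1 \<or> y = 2 \<or> y = 3 \<or> y = 4 \<or> y = 5"
        by auto
      then show "x = y" using e by (elim disjE; simp)
    qed
    then show "card (UNIV :: 5 set) \<le> card ((of_nat :: nat \<Rightarrow> 5) ` {1..5})"
      by (simp add: card_image)
  qed auto
  moreover have five: "{1..5::nat} = {1, 2, 3, 4, 5}" by auto
  ultimately have U: "(UNIV :: 5 set) = {1, 2, 3, 4, 5}" by simp
  define V :: "real^4^5" where "V = vector [q 1, q 2, q 3, q 4, q 5]"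
  have "columns (transpose V) = ($) V ` UNIV"
    by (auto simp: columns_def column_def transpose_def)
  also have "\<dots> = q ` {1..5}"
    unfolding U five by (simp only: image_insert image_empty V_def vector_5)
  finally have "columns (transpose V) = q ` {1..5}" .
  then show ?thesis by (simp add: column_rank_def dziobek_def V_def)
qed

definition net_force :: "nat \<Rightarrow> (nat \<Rightarrow> real) \<Rightarrow> (nat \<Rightarrow> real^4) \<Rightarrow> nat \<Rightarrow> real^4" where
  "net_force N m q i =
     (\<Sum>j\<in>{1..N} - {i}. (m i * m j / sin (geod_dist (q i) (q j)) ^ 3) *\<^sub>R
        (q j - cos (geod_dist (q i) (q j)) *\<^sub>R q i))"

lemma cos_geod_dist:
  assumes "norm x = 1" "norm y = 1"
  shows "cos (geod_dist x y) = x \<bullet> y"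
proof -
  have "\<bar>x \<bullet> y\<bar> \<le> 1" using Cauchy_Schwarz_ineq2[of x y] assms by simp
  then show ?thesis unfolding geod_dist_def by (intro cos_arccos) auto
qed

lemma geod_dist_commute: "geod_dist x y = geod_dist y x"
  by (simp add: geod_dist_def inner_commute)

lemma cot_geod_dist_has_derivative:
  fixes f g :: "real \<Rightarrow> real^4"
  assumes f: "(f has_vector_derivative f') (at 0)" and g: "(g has_vector_derivative g') (at 0)"
    and n: "norm (f 0) = 1" "norm (g 0) = 1" and d: "geod_dist (f 0) (g 0) \<in> {0<..<pi}"
  shows "((\<lambda>t. cot (geod_dist (f t) (g t))) has_real_derivative
           (f' \<bullet> g 0 + f 0 \<bullet> g') / sin (geod_dist (f 0) (g 0)) ^ 3) (at 0)"
proof -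
  define d where "d = geod_dist (f 0) (g 0)"
  have c: "cos d = f 0 \<bullet> g 0" unfolding d_def using n by (rule cos_geod_dist)
  have s: "sin d > 0" using assms(5) sin_gt_zero unfolding d_def by auto
  have "cos d < cos 0" "cos pi < cos d"
    using assms(5) unfolding d_def by (intro cos_monotone_0_pi; auto)+
  then have r: "-1 < f 0 \<bullet> g 0" "f 0 \<bullet> g 0 < 1" using c by auto
  have "((\<lambda>t. f t \<bullet> g t) has_vector_derivative f 0 \<bullet> g' + f' \<bullet> g 0) (at 0)"
    by (rule bounded_bilinear.has_vector_derivative[OF bounded_bilinear_inner f g])
  then have i: "((\<lambda>t. f t \<bullet> g t) has_real_derivative f 0 \<bullet> g' + f' \<bullet> g 0) (at 0)"
    by (simp add: has_real_derivative_iff_has_vector_derivative)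
  have a: "((\<lambda>t. geod_dist (f t) (g t)) has_real_derivative
              inverse (- sqrt (1 - (f 0 \<bullet> g 0)\<^sup>2)) * (f 0 \<bullet> g' + f' \<bullet> g 0)) (at 0)"
    unfolding geod_dist_def by (rule DERIV_chain2[OF DERIV_arccos[OF r] i])
  have sq: "sqrt (1 - (f 0 \<bullet> g 0)\<^sup>2) = sin d"
    using s by (simp add: c[symmetric] sin_squared_eq[symmetric])
  have "((\<lambda>t. cot (geod_dist (f t) (g t))) has_real_derivative
          - inverse ((sin d)\<^sup>2) * (inverse (- sin d) * (f 0 \<bullet> g' + f' \<bullet> g 0))) (at 0)"
    using DERIV_chain2[OF DERIV_cot a[unfolded sq]] s unfolding d_def by simp
  moreover have "- inverse ((sin d)\<^sup>2) * (inverse (- sin d) * (f 0 \<bullet> g' + f' \<bullet> g 0))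
      = (f' \<bullet> g 0 + f 0 \<bullet> g') / sin d ^ 3"
    using s by (simp add: field_simps power2_eq_square power3_eq_cube)
  ultimately show ?thesis by (simp add: d_def)
qed

lemma sum_ordered_pairs:
  fixes h :: "nat \<Rightarrow> nat \<Rightarrow> real"
  shows "(\<Sum>(i, j)\<in>{(i, j). 1 \<le> i \<and> i < j \<and> j \<le> N}. h i j + h j i)
       = (\<Sum>i\<in>{1..N}. \<Sum>j\<in>{1..N} - {i}. h i j)"
proof -
  define P where "P = {(i::nat, j). 1 \<le> i \<and> i < j \<and> j \<le> N}"
  have fin: "finite P" by (rule finite_subset[of _ "{1..N} \<times> {1..N}"]) (auto simp: P_def)
  have "(\<Sum>(i, j)\<in>P. h i j + h j i) = (\<Sum>(i, j)\<in>P. h i j) + (\<Sum>(i, j)\<in>P. h j i)"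
    by (simp add: case_prod_beta sum.distrib)
  also have "(\<Sum>(i, j)\<in>P. h j i) = (\<Sum>(i, j)\<in>prod.swap ` P. h i j)"
    by (subst sum.reindex) (auto simp: case_prod_beta)
  also have "(\<Sum>(i, j)\<in>P. h i j) + \<dots> = (\<Sum>(i, j)\<in>P \<union> prod.swap ` P. h i j)"
    using fin by (subst sum.union_disjoint) (auto simp: P_def)
  also have "P \<union> prod.swap ` P = (SIGMA i:{1..N}. {1..N} - {i})"
    by (auto simp: P_def image_iff)
  also have "(\<Sum>(i, j)\<in>\<dots>. h i j) = (\<Sum>i\<in>{1..N}. \<Sum>j\<in>{1..N} - {i}. h i j)"
    by (rule sum.Sigma[symmetric]) auto
  finally show ?thesis by (simp add: P_def)
qed

lemma potential_has_derivative:
  assumes q: "configuration N q"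
    and g: "\<And>i. i \<in> {1..N} \<Longrightarrow> \<gamma> 0 i = q i"
    and v: "\<And>i. i \<in> {1..N} \<Longrightarrow> ((\<lambda>t. \<gamma> t i) has_vector_derivative v i) (at 0)"
    and o: "\<And>i. i \<in> {1..N} \<Longrightarrow> v i \<bullet> q i = 0"
  shows "((\<lambda>t. potential N m (\<gamma> t)) has_real_derivative
           - (\<Sum>i\<in>{1..N}. v i \<bullet> net_force N m q i)) (at 0)"
proof -
  define h where "h i j = m i * m j / sin (geod_dist (q i) (q j)) ^ 3 * (v i \<bullet> q j)" for i j
  have "((\<lambda>t. m (fst p) * m (snd p) * cot (geod_dist (\<gamma> t (fst p)) (\<gamma> t (snd p))))
          has_real_derivative h (fst p) (snd p) + h (snd p) (fst p)) (at 0)"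
    if "p \<in> {(i, j). 1 \<le> i \<and> i < j \<and> j \<le> N}" for p
  proof -
    obtain i j where p: "p = (i, j)" by (cases p)
    have ij: "i \<in> {1..N}" "j \<in> {1..N}" "i \<noteq> j" using that p by auto
    have "((\<lambda>t. cot (geod_dist (\<gamma> t i) (\<gamma> t j))) has_real_derivative
           (v i \<bullet> \<gamma> 0 j + \<gamma> 0 i \<bullet> v j) / sin (geod_dist (\<gamma> 0 i) (\<gamma> 0 j)) ^ 3) (at 0)"
      using q ij by (intro cot_geod_dist_has_derivative v) (auto simp: g configuration_def)
    then have "((\<lambda>t. cot (geod_dist (\<gamma> t i) (\<gamma> t j))) has_real_derivative
           (v i \<bullet> q j + q i \<bullet> v j) / sin (geod_dist (q i) (q j)) ^ 3) (at 0)"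
      by (simp only: g[OF ij(1)] g[OF ij(2)])
    from DERIV_cmult[OF this, of "m i * m j"] show ?thesis
      by (simp add: p h_def geod_dist_commute[of "q j" "q i"] inner_commute[of "v j"]
          add_divide_distrib algebra_simps)
  qed
  then have "((\<lambda>t. potential N m (\<gamma> t)) has_real_derivative
      - (\<Sum>(i, j)\<in>{(i, j). 1 \<le> i \<and> i < j \<and> j \<le> N}. h i j + h j i)) (at 0)"
    unfolding potential_def case_prod_beta by (intro DERIV_minus DERIV_sum)
  moreover have "(\<Sum>j\<in>{1..N} - {i}. h i j) = v i \<bullet> net_force N m q i" if "i \<in> {1..N}" for i
    using o[OF that] by (simp add: net_force_def inner_sum_right h_def inner_diff_right)
  ultimately show ?thesis by (simp only: sum_ordered_pairs cong: sum.cong)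
qed

text \<open>The critical point equations in explicit form.\<close>

lemma equilibrium_configuration_iff:
  "equilibrium_configuration N m q \<longleftrightarrow>
     configuration N q \<and> (\<forall>i\<in>{1..N}. net_force N m q i = 0)"
proof (cases "configuration N q")
  case True
  have nq: "q i \<bullet> q i = 1" if "i \<in> {1..N}" for i
    using True that by (auto simp: configuration_def dot_square_norm)
  show ?thesis
  proof (intro iffI conjI ballI)
    fix k assume eq: "equilibrium_configuration N m q" and k: "k \<in> {1..N}"
    define F where "F = net_force N m q k"
    show "net_force N m q k = 0"
    proof (rule ccontr)
      assume nz: "net_force N m q k \<noteq> 0"
      define u where "u = F /\<^sub>R norm F"
      have "q k \<bullet> F = 0"
        unfolding F_def net_force_def inner_sum_right
      proof (rule sum.neutral, rule ballI)
        fix j assume "j \<in> {1..N} - {k}"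
        then have "cos (geod_dist (q k) (q j)) = q k \<bullet> q j"
          using True k by (intro cos_geod_dist) (auto simp: configuration_def)
        then show "q k \<bullet> (m k * m j / sin (geod_dist (q k) (q j)) ^ 3) *\<^sub>R
            (q j - cos (geod_dist (q k) (q j)) *\<^sub>R q k) = 0"
          by (simp add: inner_diff_right nq[OF k])
      qed
      then have uq: "q k \<bullet> u = 0" "u \<bullet> q k = 0" by (simp_all add: u_def inner_commute)
      have uu: "u \<bullet> u = 1" using nz by (simp add: u_def F_def dot_square_norm power2_eq_square)
      have uF: "u \<bullet> F = norm F" using nz by (simp add: u_def F_def dot_square_norm power2_eq_square)
      define \<gamma> where "\<gamma> t i = (if i = k then cos t *\<^sub>R q k + sin t *\<^sub>R u else q i)" for t i
      define v where "v i = (if i = k then u else 0)" for i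
      have v: "((\<lambda>t. \<gamma> t i) has_vector_derivative v i) (at 0)" for i
        unfolding \<gamma>_def v_def by (auto intro!: derivative_eq_intros)
      have g: "\<gamma> 0 i = q i" for i by (simp add: \<gamma>_def)
      have s: "\<gamma> t i \<in> sphere 0 1" if "i \<in> {1..N}" for t i
      proof -
        have "\<gamma> t i \<bullet> \<gamma> t i = 1"
          using nq[OF that] nq[OF k] uq uu sin_cos_squared_add2[of t]
          by (auto simp: \<gamma>_def inner_add_left inner_add_right power2_eq_square)
        then show ?thesis by (simp add: norm_eq_sqrt_inner)
      qed
      have "((\<lambda>t. potential N m (\<gamma> t)) has_real_derivative 0) (at 0)"
        using eq v g s unfolding equilibrium_configuration_def
        by (meson differentiableI_vector)
      moreover have "((\<lambda>t. potential N m (\<gamma> t)) has_real_derivative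
           - (\<Sum>i\<in>{1..N}. v i \<bullet> net_force N m q i)) (at 0)"
        by (rule potential_has_derivative[OF True g v]) (simp add: v_def uq)
      ultimately have "(\<Sum>i\<in>{1..N}. v i \<bullet> net_force N m q i) = 0"
        using DERIV_unique by fastforce
      also have "(\<Sum>i\<in>{1..N}. v i \<bullet> net_force N m q i) = (\<Sum>i\<in>{1..N}. if i = k then u \<bullet> F else 0)"
        by (rule sum.cong) (auto simp: v_def F_def)
      also have "\<dots> = norm F" using k uF by simp
      finally show False using nz by (simp add: F_def)
    qed
  next
    assume F: "configuration N q \<and> (\<forall>i\<in>{1..N}. net_force N m q i = 0)"
    have "((\<lambda>t. potential N m (\<gamma> t)) has_real_derivative 0) (at 0)"
      if \<gamma>: "\<forall>i\<in>{1..N}. \<gamma> 0 i = q i \<and> (\<forall>t. \<gamma> t i \<in> sphere 0 1) \<and> (\<lambda>t. \<gamma> t i) differentiable (at 0)"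
      for \<gamma> :: "real \<Rightarrow> nat \<Rightarrow> real^4"
    proof -
      define v where "v i = vector_derivative (\<lambda>t. \<gamma> t i) (at 0)" for i
      have v: "((\<lambda>t. \<gamma> t i) has_vector_derivative v i) (at 0)" if "i \<in> {1..N}" for i
        using \<gamma> that unfolding v_def by (simp add: vector_derivative_works)
      have o: "v i \<bullet> q i = 0" if i: "i \<in> {1..N}" for i
      proof -
        have "((\<lambda>t. \<gamma> t i \<bullet> \<gamma> t i) has_vector_derivative \<gamma> 0 i \<bullet> v i + v i \<bullet> \<gamma> 0 i) (at 0)"
          by (rule bounded_bilinear.has_vector_derivative[OF bounded_bilinear_inner v v]) (use i in auto)
        moreover have "(\<lambda>t. \<gamma> t i \<bullet> \<gamma> t i) = (\<lambda>t. 1)"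
          using \<gamma> i by (auto simp: dot_square_norm)
        ultimately have "\<gamma> 0 i \<bullet> v i + v i \<bullet> \<gamma> 0 i = 0"
          by (metis has_vector_derivative_const vector_derivative_unique_at)
        then show ?thesis using \<gamma> i by (simp add: inner_commute)
      qed
      have "((\<lambda>t. potential N m (\<gamma> t)) has_real_derivative
           - (\<Sum>i\<in>{1..N}. v i \<bullet> net_force N m q i)) (at 0)"
        by (rule potential_has_derivative) (use True \<gamma> v o in auto)
      then show ?thesis using F by simp
    qed
    then show "equilibrium_configuration N m q"
      using True unfolding equilibrium_configuration_def by blast
  qed (simp add: True)
qed (simp add: equilibrium_configuration_def)

end

theory Submission
  imports Defs
begin

text \<open>
  The vector \<open>(\<Delta>\<^sub>1, \<dots>, \<Delta>\<^sub>5)\<close> spans the kernel of \<open>X\<close> when \<open>X\<close> has rank 4. The equilibrium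
  equation of body \<open>i\<close> says that \<open>m\<^sub>j / sin\<^sup>3 d\<^sub>i\<^sub>j\<close>, with a suitable \<open>i\<close>-th entry, lies in this
  kernel, so it equals \<open>\<lambda>\<^sub>i \<Delta>\<^sub>j\<close>. By the symmetry \<open>d\<^sub>i\<^sub>j = d\<^sub>j\<^sub>i\<close>, the matrix
  \<open>1 / sin\<^sup>3 d\<^sub>i\<^sub>j\<close> is off the diagonal a multiple of \<open>(\<Delta>\<^sub>i / m\<^sub>i) (\<Delta>\<^sub>j / m\<^sub>j)\<close>; the conditions on the sines
  and the masses express exactly this rank one structure.
\<close>

section \<open>The determinants \<open>Delta\<close> and the kernel of the coordinate matrix\<close>

text \<open>Laplace expansion with explicit signs turns identities between the
  \<open>Delta q k\<close> into polynomial identities in the coordinates.\<close>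

lemma det_4:
  fixes A :: "'a::comm_ring_1^4^4"
  shows "det A =
    A$1$1 * (A$2$2 * (A$3$3 * A$4$4 - A$3$4 * A$4$3) - A$2$3 * (A$3$2 * A$4$4 - A$3$4 * A$4$2)
      + A$2$4 * (A$3$2 * A$4$3 - A$3$3 * A$4$2)) -
    A$1$2 * (A$2$1 * (A$3$3 * A$4$4 - A$3$4 * A$4$3) - A$2$3 * (A$3$1 * A$4$4 - A$3$4 * A$4$1)
      + A$2$4 * (A$3$1 * A$4$3 - A$3$3 * A$4$1)) +
    A$1$3 * (A$2$1 * (A$3$2 * A$4$4 - A$3$4 * A$4$2) - A$2$2 * (A$3$1 * A$4$4 - A$3$4 * A$4$1)
      + A$2$4 * (A$3$1 * A$4$2 - A$3$2 * A$4$1)) -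
    A$1$4 * (A$2$1 * (A$3$2 * A$4$3 - A$3$3 * A$4$2) - A$2$2 * (A$3$1 * A$4$3 - A$3$3 * A$4$1)
      + A$2$3 * (A$3$1 * A$4$2 - A$3$2 * A$4$1))"
proof -
  have f1: "finite {2::4, 3, 4}" "1 \<notin> {2::4, 3, 4}"
    and f2: "finite {3::4, 4}" "2 \<notin> {3::4, 4}"
    and f3: "finite {4::4}" "3 \<notin> {4::4}" by auto
  show ?thesis
    unfolding det_def UNIV_4
    unfolding sum_over_permutations_insert[OF f1] sum_over_permutations_insert[OF f2]
      sum_over_permutations_insert[OF f3]
    unfolding permutes_sing
    by (simp add: sign_swap_id permutation_swap_id sign_compose sign_id swap_id_eq
        permutation_compose algebra_simps)
qed

text \<open>Coordinate \<open>r\<close> of the sum is the expansion, along its first row, of the 5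
  by 5 determinant obtained by placing row \<open>r\<close> of the coordinate matrix on top of that
  matrix. Two of its rows agree, so it vanishes.\<close>

lemma sum_Delta_scaleR: "(\<Sum>k\<in>{1..5}. Delta q k *\<^sub>R q k) = 0"
proof -
  have five: "{Suc 0..5} = {1, 2, 3, 4, 5}" by auto
  have "(\<Sum>k\<in>{1..5}. Delta q k *\<^sub>R q k) $ r = 0" for r
    using exhaust_4[of r]
    by (elim disjE; simp add: five Delta_def delete_column_def det_4 transpose_def vector_4;
        simp add: algebra_simps)
  then show ?thesis by (simp add: vec_eq_iff)
qed

lemma columns_delete_column:
  assumes "k \<in> {1..5}"
  shows "columns (delete_column q k) = q ` ({1..5} - {k})"
proof -
  have five: "{Suc 0..5} = {1, 2, 3, 4, 5}" by auto
  have "columns (delete_column q k) = (\<lambda>j. column j (delete_column q k)) ` {1, 2, 3, 4}"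
    unfolding UNIV_4[symmetric] by (auto simp: columns_def)
  also have "\<dots> = q ` ({1..5} - {k})"
  proof -
    have "k = 1 \<or> k = 2 \<or> k = 3 \<or> k = 4 \<or> k = 5" using assms by auto
    then show ?thesis
      using column_delete_column[OF assms, of 1 q] column_delete_column[OF assms, of 2 q]
        column_delete_column[OF assms, of 3 q] column_delete_column[OF assms, of 4 q]
      by (elim disjE; simp add: five insert_Diff_if flip: numeral_2_eq_2)
  qed
  finally show ?thesis .
qed

lemma Delta_nonzero_iff:
  assumes "k \<in> {1..5}"
  shows "Delta q k \<noteq> 0 \<longleftrightarrow> span (q ` ({1..5} - {k})) = UNIV"
proof -
  have "Delta q k \<noteq> 0 \<longleftrightarrow> invertible (delete_column q k)"
    by (simp add: Delta_def invertible_det_nz)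
  also have "\<dots> \<longleftrightarrow> span (columns (delete_column q k)) = UNIV"
    by (simp add: invertible_right_inverse matrix_right_invertible_span_columns span_vec_eq)
  finally show ?thesis by (simp add: columns_delete_column[OF assms])
qed

text \<open>Rank 4 means that some four of the five vectors already form a basis; the index left out
  is the \<open>k\<close>.\<close>

lemma dziobek_5_iff_Delta: "dziobek 5 q \<longleftrightarrow> (\<exists>k\<in>{1..5}. Delta q k \<noteq> 0)"
proof
  assume "dziobek 5 q"
  then have dim: "dim (q ` {1..5}) = 4" by (simp add: dziobek_def)
  obtain B where B: "B \<subseteq> q ` {1..5}" "independent B" "card B = 4"
    using basis_exists[of "q ` {1..5}"] dim by metis
  \<comment> \<open>Values of \<open>q\<close> may repeat here, so the basis is lifted to an index
    set on which \<open>q\<close> is injective.\<close>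
  obtain I where I: "I \<subseteq> {1..5}" "inj_on q I" "B = q ` I"
    using B(1) unfolding subset_image_inj by blast
  have "card I = 4" using B(3) I by (simp add: card_image)
  then have "card ({1..5} - I) = 1" using I(1) by (simp add: card_Diff_subset finite_subset)
  then obtain k where k: "{1..5} - I = {k}" by (auto simp: card_1_singleton_iff)
  then have "I = {1..5} - {k}" "k \<in> {1..5}" using I(1) by auto
  moreover have "span B = UNIV"
    using card_ge_dim_independent[of B UNIV] B by auto
  ultimately show "\<exists>k\<in>{1..5}. Delta q k \<noteq> 0" using Delta_nonzero_iff I(3) by blast
next
  assume "\<exists>k\<in>{1..5}. Delta q k \<noteq> 0"
  then obtain k where "k \<in> {1..5}" "span (q ` ({1..5} - {k})) = UNIV"
    using Delta_nonzero_iff by blast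
  then have "span (q ` {1..5}) = UNIV"
    using span_mono[of "q ` ({1..5} - {k})" "q ` {1..5}"] by blast
  then have "dim (q ` {1..5}) = 4" using dim_span[of "q ` {1..5}"] by simp
  then show "dziobek 5 q" by (simp add: dziobek_def)
qed

text \<open>Four vectors spanning a space of dimension 4 must be pairwise distinct and independent.
  Distinctness allows the indexed sum to be read as a sum over the set of vectors.\<close>

lemma sum_scaleR_eq_0_imp:
  assumes k: "k \<in> {1..5}" and D: "Delta q k \<noteq> 0"
    and w: "(\<Sum>j\<in>{1..5} - {k}. w j *\<^sub>R q j) = 0" and j: "j \<in> {1..5} - {k}"
  shows "w j = 0"
proof -
  define J where "J = {1..5} - {k}"
  have "card J = 4" using k by (simp add: J_def)
  have fin: "finite J" by (simp add: J_def)
  have sp: "span (q ` J) = UNIV" using D Delta_nonzero_iff[OF k] by (simp add: J_def)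
  have "dim (q ` J) = 4" using sp dim_span[of "q ` J"] by simp
  then have "card (q ` J) \<ge> 4" using dim_le_card'[of "q ` J"] fin by simp
  then have c: "card (q ` J) = card J"
    using card_image_le[OF fin, of q] \<open>card J = 4\<close> by simp
  have inj: "inj_on q J" using c fin by (simp add: eq_card_imp_inj_on)
  have ind: "independent (q ` J)"
    using card_le_dim_spanning[of "q ` J" UNIV] sp fin c \<open>card J = 4\<close> by simp
  have "(\<Sum>x\<in>q ` J. w (the_inv_into J q x) *\<^sub>R x) = 0"
    using w inj by (simp add: sum.reindex the_inv_into_f_f del: One_nat_def flip: J_def)
  then have "w (the_inv_into J q (q j)) = 0"
    using j by (intro independentD[OF ind finite_imageI[OF fin] order_refl]) (auto simp: J_def)
  then show ?thesis using the_inv_into_f_f[OF inj] j by (simp add: J_def)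
qed

text \<open>Subtracting the multiple of the \<open>Delta\<close> relation that cancels the
  coefficient at \<open>k\<close> leaves a relation among four independent vectors, which is
  trivial.\<close>

lemma kernel_eq_multiple_Delta:
  assumes k: "k \<in> {1..5}" and D: "Delta q k \<noteq> 0" and w: "(\<Sum>j\<in>{1..5}. w j *\<^sub>R q j) = 0"
  shows "\<exists>l. \<forall>j\<in>{1..5}. w j = l * Delta q j"
proof -
  define l where "l = w k / Delta q k"
  have "(\<Sum>j\<in>{1..5}. (w j - l * Delta q j) *\<^sub>R q j)
      = (\<Sum>j\<in>{1..5}. w j *\<^sub>R q j) - l *\<^sub>R (\<Sum>j\<in>{1..5}. Delta q j *\<^sub>R q j)"
    by (simp add: scaleR_diff_left sum_subtractf scaleR_sum_right)
  also have "\<dots> = 0" using w sum_Delta_scaleR[of q] by simp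
  finally have "(\<Sum>j\<in>{1..5} - {k}. (w j - l * Delta q j) *\<^sub>R q j) = 0"
    using D unfolding sum.remove[OF finite_atLeastAtMost k] by (simp add: l_def)
  from sum_scaleR_eq_0_imp[OF k D this] have "w j = l * Delta q j" if "j \<in> {1..5}" for j
    using that D by (cases "j = k") (auto simp: l_def)
  then show ?thesis by blast
qed

section \<open>The equilibrium equations as a condition on the kernel\<close>

text \<open>Up to the factor \<open>m i\<close>, the net force is the projection of the sum
  \<open>S\<close> onto the tangent space at \<open>q i\<close>. It vanishes exactly when
  \<open>S\<close> is parallel to \<open>q i\<close>.\<close>

lemma net_force_eq_0_iff:
  assumes q: "configuration N q" and i: "i \<in> {1..N}" and m: "m i \<noteq> 0"
  shows "net_force N m q i = 0 \<longleftrightarrow>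
    (\<exists>c. (\<Sum>j\<in>{1..N} - {i}. (m j / sin (geod_dist (q i) (q j)) ^ 3) *\<^sub>R q j) = c *\<^sub>R q i)"
proof -
  define S where "S = (\<Sum>j\<in>{1..N} - {i}. (m j / sin (geod_dist (q i) (q j)) ^ 3) *\<^sub>R q j)"
  have ii: "q i \<bullet> q i = 1" using q i by (auto simp: configuration_def dot_square_norm)
  have "net_force N m q i = m i *\<^sub>R (S - (q i \<bullet> S) *\<^sub>R q i)"
  proof -
    have "cos (geod_dist (q i) (q j)) = q i \<bullet> q j" if "j \<in> {1..N} - {i}" for j
      using that q i by (intro cos_geod_dist) (auto simp: configuration_def)
    then show ?thesis
      unfolding net_force_def S_def
      by (simp add: inner_sum_right scaleR_sum_left scaleR_sum_right scaleR_diff_right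
          sum_subtractf mult_ac)
  qed
  then have "net_force N m q i = 0 \<longleftrightarrow> S = (q i \<bullet> S) *\<^sub>R q i" using m by simp
  also have "\<dots> \<longleftrightarrow> (\<exists>c. S = c *\<^sub>R q i)" using ii by auto
  finally show ?thesis by (simp add: S_def)
qed

lemma dziobek_equilibrium_configuration_5_iff:
  assumes m: "\<forall>i\<in>{1..5}. 0 < m i" and q: "configuration 5 q"
  shows "dziobek_equilibrium_configuration 5 m q \<longleftrightarrow> Delta q 5 \<noteq> 0 \<and>
    (\<exists>l. \<forall>i\<in>{1..5}. \<forall>j\<in>{1..5} - {i}. m j / sin (geod_dist (q i) (q j)) ^ 3 = l i * Delta q j)"
    (is "_ \<longleftrightarrow> _ \<and> (\<exists>l. ?P l)")
proof
  define f where "f i j = m j / sin (geod_dist (q i) (q j)) ^ 3" for i j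
  assume *: "dziobek_equilibrium_configuration 5 m q"
  then obtain k where k: "k \<in> {1..5}" "Delta q k \<noteq> 0"
    unfolding dziobek_equilibrium_configuration_def dziobek_5_iff_Delta by blast
  have "\<exists>l. \<forall>j\<in>{1..5} - {i}. f i j = l * Delta q j" if i: "i \<in> {1..5}" for i
  proof -
    have mi: "m i \<noteq> 0" using m i by force
    have "net_force 5 m q i = 0"
      using * i by (simp add: dziobek_equilibrium_configuration_def equilibrium_configuration_iff)
    then obtain c where c: "(\<Sum>j\<in>{1..5} - {i}. f i j *\<^sub>R q j) = c *\<^sub>R q i"
      unfolding net_force_eq_0_iff[where m = m, OF q i mi] f_def by blast
    \<comment> \<open>The entry \<open>- c\<close> at \<open>i\<close> moves the right-hand side
      into the sum, which makes \<open>w\<close> a kernel vector.\<close>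
    define w where "w j = (if j = i then - c else f i j)" for j
    have "(\<Sum>j\<in>{1..5} - {i}. w j *\<^sub>R q j) = (\<Sum>j\<in>{1..5} - {i}. f i j *\<^sub>R q j)"
      by (rule sum.cong) (auto simp: w_def)
    then have "(\<Sum>j\<in>{1..5}. w j *\<^sub>R q j) = 0"
      using c unfolding sum.remove[OF finite_atLeastAtMost i] by (simp add: w_def del: One_nat_def)
    from kernel_eq_multiple_Delta[OF k this] obtain l where "\<forall>j\<in>{1..5}. w j = l * Delta q j" by blast
    then have "f i j = l * Delta q j" if "j \<in> {1..5} - {i}" for j
      using that unfolding w_def by (metis DiffD1 DiffD2 singletonI)
    then show ?thesis by blast
  qed
  then obtain l where l: "\<forall>i\<in>{1..5}. \<forall>j\<in>{1..5} - {i}. f i j = l i * Delta q j"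
    by metis
  \<comment> \<open>The rank condition gives only some nonzero \<open>Delta q k\<close>; positive
    masses and sines force index 5 to be one of them.\<close>
  have "f 1 5 > 0"
    using q m by (auto simp: f_def configuration_def intro!: divide_pos_pos sin_gt_zero)
  moreover have "f 1 5 = l 1 * Delta q 5" using l by simp
  ultimately have "Delta q 5 \<noteq> 0" by auto
  with l show "Delta q 5 \<noteq> 0 \<and> (\<exists>l. ?P l)" unfolding f_def by blast
next
  assume "Delta q 5 \<noteq> 0 \<and> (\<exists>l. ?P l)"
  then obtain l where D: "Delta q 5 \<noteq> 0" and l: "?P l" by blast
  have "net_force 5 m q i = 0" if i: "i \<in> {1..5}" for i
  proof -
    have mi: "m i \<noteq> 0" using m i by force
    have "(\<Sum>j\<in>{1..5} - {i}. (m j / sin (geod_dist (q i) (q j)) ^ 3) *\<^sub>R q j)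
        = (\<Sum>j\<in>{1..5} - {i}. l i *\<^sub>R Delta q j *\<^sub>R q j)"
      using l i by (intro sum.cong) auto
    \<comment> \<open>The only term missing from the full \<open>Delta\<close> relation is the one
      at \<open>i\<close>, so the sum is parallel to \<open>q i\<close>.\<close>
    also have "\<dots> = l i *\<^sub>R ((\<Sum>j\<in>{1..5}. Delta q j *\<^sub>R q j) - Delta q i *\<^sub>R q i)"
      by (simp add: sum_diff1 i[simplified] scaleR_sum_right scaleR_diff_right)
    also have "\<dots> = (- l i * Delta q i) *\<^sub>R q i" using sum_Delta_scaleR[of q] by simp
    finally show ?thesis unfolding net_force_eq_0_iff[where m = m, OF q i mi] by blast
  qed
  moreover have "dziobek 5 q" using D dziobek_5_iff_Delta by fastforce
  ultimately show "dziobek_equilibrium_configuration 5 m q"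
    using q by (simp add: dziobek_equilibrium_configuration_def equilibrium_configuration_iff)
qed

section \<open>The rank one structure in terms of sines and masses\<close>

theorem corollary3:
  fixes m :: "nat \<Rightarrow> real" and q :: "nat \<Rightarrow> real^4"
  defines "d \<equiv> \<lambda>i j. geod_dist (q i) (q j)"
  assumes "\<forall>i\<in>{1..5}. 0 < m i"
    and "configuration 5 q"
  shows "dziobek_equilibrium_configuration 5 m q \<longleftrightarrow>
      sin (d 1 3) * sin (d 2 5) = sin (d 1 2) * sin (d 3 5) \<and>
      sin (d 1 2) * sin (d 3 5) = sin (d 2 3) * sin (d 1 5) \<and>
      sin (d 3 4) * sin (d 1 5) = sin (d 1 4) * sin (d 3 5) \<and>
      sin (d 1 4) * sin (d 2 5) = sin (d 1 2) * sin (d 4 5) \<and>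
      sin (d 1 2) * sin (d 4 5) = sin (d 2 4) * sin (d 1 5) \<and>
      Delta q 5 \<noteq> 0 \<and>
      (m 1, m 2, m 3, m 4, m 5) =
        (sin (d 1 2) ^ 3 * Delta q 1 / (sin (d 2 5) ^ 3 * Delta q 5) * m 5,
         sin (d 1 2) ^ 3 * Delta q 2 / (sin (d 1 5) ^ 3 * Delta q 5) * m 5,
         sin (d 1 3) ^ 3 * Delta q 3 / (sin (d 1 5) ^ 3 * Delta q 5) * m 5,
         sin (d 1 4) ^ 3 * Delta q 4 / (sin (d 1 5) ^ 3 * Delta q 5) * m 5,
         1 * m 5)"
    (is "_ \<longleftrightarrow> ?R")
proof -
  define s where "s i j = sin (d i j)" for i j
  note m = assms(2) and q = assms(3)
  have s: "s i j > 0" if "i \<in> {1..5}" "j \<in> {1..5}" "i \<noteq> j" for i j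
    using q that by (auto simp: s_def d_def configuration_def intro!: sin_gt_zero)
  have sym: "s i j = s j i" for i j by (simp add: s_def d_def geod_dist_commute)
  let ?P = "\<lambda>l. \<forall>i\<in>{1..5}. \<forall>j\<in>{1..5} - {i}. m j / s i j ^ 3 = l i * Delta q j"
  have necessary: "?R" if D: "Delta q 5 \<noteq> 0" and "?P l" for l
  proof -
    have P: "m j / s i j ^ 3 = l i * Delta q j" if "i \<in> {1..5}" "j \<in> {1..5}" "i \<noteq> j" for i j
      using \<open>?P l\<close> that by auto
    \<comment> \<open>Dividing out the masses makes the left side of \<open>inv\<close> symmetric in
      \<open>i\<close> and \<open>j\<close>, whereas the right side is a product.\<close>
    define a where "a i = Delta q i / m i" for i
    have inv: "1 / s i j ^ 3 = l i * a j" if "i \<in> {1..5}" "j \<in> {1..5}" "i \<noteq> j" for i j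
      using P[OF that] m that(2) by (force simp: a_def field_simps)
    \<comment> \<open>Symmetry gives \<open>l k * a j = l j * a k\<close>, so \<open>j\<close> and
      \<open>k\<close> can be exchanged in a product of two entries. Positivity then permits taking
      cube roots.\<close>
    have ex: "s i j * s k n = s i k * s j n"
      if "i \<in> {1..5}" "j \<in> {1..5}" "k \<in> {1..5}" "n \<in> {1..5}" "i \<noteq> j" "i \<noteq> k" "j \<noteq> k" "j \<noteq> n" "k \<noteq> n"
      for i j k n
    proof -
      have "l k * a j = l j * a k" using inv[of k j] inv[of j k] sym[of k j] that by simp
      then have "(l i * a j) * (l k * a n) = (l i * a k) * (l j * a n)" by algebra
      then have "(1 / s i j ^ 3) * (1 / s k n ^ 3) = (1 / s i k ^ 3) * (1 / s j n ^ 3)"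
        using that by (simp only: inv not_False_eq_True)
      then have "1 / (s i j * s k n) ^ 3 = 1 / (s i k * s j n) ^ 3"
        by (simp add: power_mult_distrib)
      then have "(s i j * s k n) ^ 3 = (s i k * s j n) ^ 3" by simp
      moreover have "s i j * s k n > 0" "s i k * s j n > 0" using s that by simp_all
      ultimately show ?thesis by (metis less_imp_le power_eq_imp_eq_base zero_less_numeral)
    qed
    \<comment> \<open>Comparing the entries \<open>j\<close> and 5 of the same row \<open>i\<close>
      eliminates the unknown \<open>l i\<close>.\<close>
    have mass: "m j = s i j ^ 3 * Delta q j / (s i 5 ^ 3 * Delta q 5) * m 5"
      if "i \<in> {1..4}" "j \<in> {1..5}" "i \<noteq> j" for i j
    proof -
      have "s i j > 0" "s i 5 > 0" using s that by auto
      moreover from this have "m j = l i * Delta q j * s i j ^ 3" "m 5 = l i * Delta q 5 * s i 5 ^ 3"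
        using P[of i j] P[of i 5] that by (auto simp: field_simps)
      ultimately show ?thesis using D by simp
    qed
    show ?R
      \<comment> \<open>Row 1 yields the masses 2, 3 and 4; having no diagonal entry, it cannot
        yield \<open>m 1\<close>, which is read off from row 2.\<close>
      using ex[of 1 3 2 5] ex[of 2 1 3 5] ex[of 4 3 1 5] ex[of 1 4 2 5] ex[of 2 1 4 5]
        mass[of 2 1] mass[of 1 2] mass[of 1 3] mass[of 1 4] D
      by (simp add: sym[of 2 "Suc 0"] sym[of 4 "Suc 0"] sym[of 4 3] flip: s_def)
  qed
  have sufficient: "Delta q 5 \<noteq> 0 \<and> (\<exists>l. ?P l)" if R: "?R"
  proof -
    have D: "Delta q 5 \<noteq> 0" using R by simp
    txt \<open>Up to a common factor, \<open>b i\<close> is the cube root of \<open>Delta q i / m i\<close>.\<close>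
    define b where "b i = (if i = 1 then s 2 5 / s 1 2 else if i = 2 then s 1 5 / s 1 2
      else if i = 3 then s 1 5 / s 1 3 else if i = 4 then s 1 5 / s 1 4 else 1)" for i :: nat
    have b_eqs: "b 1 = s 2 5 / s 1 2" "b 2 = s 1 5 / s 1 2" "b 3 = s 1 5 / s 1 3" "b 4 = s 1 5 / s 1 4"
      "b 5 = 1"
      by (simp_all add: b_def)
    \<comment> \<open>This is the value of \<open>s i j * b i * b j\<close> at the pair (2, 5),
      where \<open>b 5 = 1\<close>; it turns out to be the same for all pairs.\<close>
    define \<kappa> where "\<kappa> = s 1 5 * s 2 5 / s 1 2"
    have pos: "s 1 2 > 0" "s 1 3 > 0" "s 1 4 > 0" "s 1 5 > 0" "s 2 5 > 0" using s by auto
    have b: "b i > 0" for i using pos by (simp add: b_def)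
    have idx: "i = 1 \<or> i = 2 \<or> i = 3 \<or> i = 4 \<or> i = 5" if "i \<in> {1..5}" for i :: nat
      using that by auto
    have R': "s 1 3 * s 2 5 = s 1 2 * s 3 5" "s 1 2 * s 3 5 = s 2 3 * s 1 5"
      "s 3 4 * s 1 5 = s 1 4 * s 3 5" "s 1 4 * s 2 5 = s 1 2 * s 4 5" "s 1 2 * s 4 5 = s 2 4 * s 1 5"
      using R by (simp_all add: s_def)
    have masses: "m 1 = s 1 2 ^ 3 * Delta q 1 / (s 2 5 ^ 3 * Delta q 5) * m 5"
      "m 2 = s 1 2 ^ 3 * Delta q 2 / (s 1 5 ^ 3 * Delta q 5) * m 5"
      "m 3 = s 1 3 ^ 3 * Delta q 3 / (s 1 5 ^ 3 * Delta q 5) * m 5"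
      "m 4 = s 1 4 ^ 3 * Delta q 4 / (s 1 5 ^ 3 * Delta q 5) * m 5"
      using R by (simp_all only: s_def prod.inject)
    \<comment> \<open>The five sine conditions express the remaining five sines through
      \<open>s 1 2\<close>, \<open>s 1 3\<close>, \<open>s 1 4\<close>, \<open>s 1 5\<close> and
      \<open>s 2 5\<close>, the ones occurring in \<open>b\<close>.\<close>
    have s35: "s 3 5 = s 1 3 * s 2 5 / s 1 2" and s45: "s 4 5 = s 1 4 * s 2 5 / s 1 2"
      using R' pos by (simp_all add: eq_divide_eq mult_ac)
    have "s 2 3 = s 1 2 * s 3 5 / s 1 5" "s 3 4 = s 1 4 * s 3 5 / s 1 5" "s 2 4 = s 1 2 * s 4 5 / s 1 5"
      using R' pos by (simp_all add: eq_divide_eq mult_ac)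
    note eqs = s35 s45 this[unfolded s35 s45]
    have edges: "s 1 2 * b 1 * b 2 = \<kappa>" "s 1 3 * b 1 * b 3 = \<kappa>" "s 1 4 * b 1 * b 4 = \<kappa>"
      "s 1 5 * b 1 * b 5 = \<kappa>" "s 2 3 * b 2 * b 3 = \<kappa>" "s 2 4 * b 2 * b 4 = \<kappa>"
      "s 2 5 * b 2 * b 5 = \<kappa>" "s 3 4 * b 3 * b 4 = \<kappa>" "s 3 5 * b 3 * b 5 = \<kappa>"
      "s 4 5 * b 4 * b 5 = \<kappa>"
      using pos unfolding b_eqs \<kappa>_def eqs by simp_all
    have up: "s i j * b i * b j = \<kappa>" if "i \<in> {1..5}" "j \<in> {1..5}" "i < j" for i j
    proof -
      have "(i, j) \<in> {(1, 2), (1, 3), (1, 4), (1, 5), (2, 3), (2, 4), (2, 5), (3, 4), (3, 5),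
          (4, 5)}"
        using idx[OF that(1)] idx[OF that(2)] that(3) by (elim disjE) simp_all
      then show ?thesis
        unfolding insert_iff empty_iff prod.inject using edges by blast
    qed
    have sbb: "s i j * b i * b j = \<kappa>" if "i \<in> {1..5}" "j \<in> {1..5}" "i \<noteq> j" for i j
    proof (cases "i < j")
      case True
      with that show ?thesis by (intro up)
    next
      case False
      then have "s j i * b j * b i = \<kappa>" using that by (intro up) auto
      then show ?thesis by (subst sym) (simp only: mult_ac)
    qed
    have mass: "m j = m 5 / Delta q 5 * Delta q j / b j ^ 3" if "j \<in> {1..5}" for j
    proof -
      have "m 1 = m 5 / Delta q 5 * Delta q 1 / b 1 ^ 3" "m 2 = m 5 / Delta q 5 * Delta q 2 / b 2 ^ 3"
        "m 3 = m 5 / Delta q 5 * Delta q 3 / b 3 ^ 3" "m 4 = m 5 / Delta q 5 * Delta q 4 / b 4 ^ 3"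
        "m 5 = m 5 / Delta q 5 * Delta q 5 / b 5 ^ 3"
        unfolding b_eqs using masses D by (simp_all add: power_divide mult_ac)
      with idx[OF that] show ?thesis by blast
    qed
    \<comment> \<open>By \<open>mass\<close>, \<open>m j\<close> is proportional to
      \<open>Delta q j / b j ^ 3\<close>, and \<open>sbb\<close> gives
      \<open>1 / (b j * s i j) = b i / \<kappa>\<close>. Hence the factor of
      \<open>Delta q j\<close> depends on \<open>i\<close> alone and serves as the multiplier
      \<open>l i\<close>.\<close>
    have "m j / s i j ^ 3 = (m 5 / Delta q 5 * (b i / \<kappa>) ^ 3) * Delta q j"
      if "i \<in> {1..5}" "j \<in> {1..5}" "i \<noteq> j" for i j
    proof -
      have "\<kappa> > 0" using pos by (simp add: \<kappa>_def)
      then have "1 / (b j * s i j) = b i / \<kappa>"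
        using sbb[OF that] b[of i] b[of j] s[OF that] by (auto simp: field_simps)
      then have "1 / (b j ^ 3 * s i j ^ 3) = (b i / \<kappa>) ^ 3"
        by (metis power_mult_distrib power_one_over)
      moreover have "m j / s i j ^ 3 = m 5 / Delta q 5 * (1 / (b j ^ 3 * s i j ^ 3)) * Delta q j"
        by (subst mass[OF that(2)]) simp
      ultimately show ?thesis by simp
    qed
    then have "?P (\<lambda>i. m 5 / Delta q 5 * (b i / \<kappa>) ^ 3)" by auto
    with D show ?thesis by (intro conjI exI)
  qed
  have "dziobek_equilibrium_configuration 5 m q \<longleftrightarrow> Delta q 5 \<noteq> 0 \<and> (\<exists>l. ?P l)"
    unfolding s_def d_def by (rule dziobek_equilibrium_configuration_5_iff[OF m q])
  also have "\<dots> \<longleftrightarrow> ?R"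
  proof
    assume "Delta q 5 \<noteq> 0 \<and> (\<exists>l. ?P l)"
    then show ?R by (elim conjE exE) (rule necessary)
  qed (rule sufficient)
  finally show ?thesis .
qed

end
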